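(* $f_3(k)=O(k^{43})$; that is, there exist constants $C,K$ such that $f_3(k)\leq Ck^{43}$ for all integers $k\geq K$.
   Context: A 3-coloring of a set $A\subseteq\mathbb{N}$ is a function $\Delta:A\to\{0,1,2\}$. For integers $r,k\geq 2$, $f_r(k)$ denotes the smallest positive integer $n$ such that every $r$-coloring $\Delta$ of $\{1,2,\ldots,n\}$ has a monochromatic solution to $1/x_1+\cdots+1/x_k=1/y$, i.e. elements $a_1,\ldots,a_k,b$ (with $a_1,\ldots,a_k$ not necessarily distinct) with $1/a_1+\cdots+1/a_k=1/b$ and $\Delta(a_1)=\cdots=\Delta(a_k)=\Delta(b)$. *)

theory Defs
  imports Complex_Main "HOL-Library.FuncSet" "HOL-Library.Extended_Real"
begin

definition is_coloring :: "nat \<Rightarrow> nat set \<Rightarrow> (nat \<Rightarrow> nat) \<Rightarrow> bool" where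
  "is_coloring r A \<Delta> \<longleftrightarrow> \<Delta> \<in> A \<rightarrow> {0..<r}"

definition has_mono_solution :: "nat \<Rightarrow> nat set \<Rightarrow> (nat \<Rightarrow> nat) \<Rightarrow> bool" where
  "has_mono_solution k A \<Delta> \<longleftrightarrow>
     (\<exists>a b. (\<forall>i\<in>{1..k}. a i \<in> A) \<and> b \<in> A \<and>
        (\<Sum>i=1..k. 1 / real (a i)) = 1 / real b \<and>
        (\<forall>i\<in>{1..k}. \<Delta> (a i) = \<Delta> b))"

text \<open>The minimum is taken in \<^typ>\<open>enat\<close>, so that the value is \<open>\<infinity>\<close>, rather than an unspecified
  number, in case no suitable \<open>n\<close> exists; a finite upper bound thus includes existence.\<close>

definition f_rado :: "nat \<Rightarrow> nat \<Rightarrow> enat" where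
  "f_rado r k = Inf {enat n | n. n > 0 \<and>
     (\<forall>\<Delta>. is_coloring r {1..n} \<Delta> \<longrightarrow> has_mono_solution k {1..n} \<Delta>)}"

end

theory Submission
  imports Defs "HOL-Real_Asymp.Real_Asymp"
begin

text \<open>
  If \<open>L\<close> is a common multiple of \<open>x\<close>, \<open>y\<close>, \<open>z\<close> and \<open>x + (k - 1) * y = z\<close>, then the reciprocals of \<open>L / x\<close>
  and of \<open>k - 1\<close> copies of \<open>L / y\<close> sum to the reciprocal of \<open>L / z\<close>. Colouring \<open>x\<close> by the colour of
  \<open>L / x\<close>, it therefore suffices to find finitely many polynomials in \<open>k\<close> whose least common multiple
  has degree at most 43, up to a constant factor, and which cannot be 3-coloured without a
  monochromatic solution of \<open>x + (k - 1) * y = z\<close>. The 38 polynomials used here, and the 123 solutions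
  among them that already exclude every 3-colouring, were found by a computer search.
\<close>

section \<open>Passing from reciprocals to divisors of a common multiple\<close>

lemma int_quotient_in_range:
  fixes d L :: int
  assumes "d dvd L" "0 < d" "0 < L" "L \<le> int n"
  shows "nat (L div d) \<in> {1..n}"
proof -
  obtain e where e: "L = d * e" using assms(1) by blast
  have "0 < e" using e assms by (simp add: zero_less_mult_iff)
  moreover have "e \<le> int n" using e assms \<open>0 < e\<close> mult_right_mono[of 1 d e] by linarith
  ultimately show ?thesis
    using e assms by auto
qed

text \<open>Dividing \<open>x + (k - 1) * y = z\<close> by \<open>L\<close> gives an equation
  between reciprocals of the exact quotients \<open>L div x\<close>, \<open>L div y\<close> and
  \<open>L div z\<close>, all of which lie in \<open>{1..n}\<close>. The colour \<open>i\<close> is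
  a variable of its own so that the conclusion speaks of a single colour class, as the clauses of
  \<open>test_polys_sum_free\<close> do.\<close>

lemma divisor_colouring_sum_free:
  fixes x y z L :: int and k n :: nat
  assumes free: "\<not> has_mono_solution k {1..n} \<Delta>" and "0 < k"
    and L: "0 < L" "L \<le> int n"
    and dvd: "x dvd L" "y dvd L" "z dvd L"
    and pos: "0 < x" "0 < y" "0 < z"
    and sum: "x + (int k - 1) * y = z"
  shows "\<not> (\<Delta> (nat (L div x)) = i \<and> \<Delta> (nat (L div y)) = i \<and> \<Delta> (nat (L div z)) = i)"
proof
  assume mono: "\<Delta> (nat (L div x)) = i \<and> \<Delta> (nat (L div y)) = i \<and> \<Delta> (nat (L div z)) = i"
  define a where "a j = nat (L div (if j = 1 then x else y))" for j :: nat
  have range: "nat (L div d) \<in> {1..n}" if "d dvd L" "0 < d" for d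
    using int_quotient_in_range that L .
  have quot: "1 / real (nat (L div d)) = d / L" if "d dvd L" "0 < d" for d
    using that L by (auto simp: dvd_def zero_less_mult_iff)
  have "(\<Sum>j=1..k. 1 / real (a j)) = 1 / real (a 1) + (\<Sum>j=2..k. 1 / real (a j))"
    using \<open>0 < k\<close> by (simp add: sum.atLeast_Suc_atMost numeral_2_eq_2)
  also have "(\<Sum>j=2..k. 1 / real (a j)) = (\<Sum>j=2..k. y / L)"
    using dvd pos by (intro sum.cong refl) (auto simp: a_def quot)
  also have "1 / real (a 1) + (\<Sum>j=2..k. y / L) = (x + (int k - 1) * y) / L"
    using \<open>0 < k\<close> dvd pos by (simp add: a_def quot add_divide_distrib of_nat_diff)
  also have "\<dots> = 1 / real (nat (L div z))"
    unfolding sum using dvd pos quot by simp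
  finally have "(\<Sum>j=1..k. 1 / real (a j)) = 1 / real (nat (L div z))" .
  moreover have "\<forall>j\<in>{1..k}. a j \<in> {1..n}" "\<forall>j\<in>{1..k}. \<Delta> (a j) = \<Delta> (nat (L div z))"
    using range dvd pos mono by (auto simp: a_def simp del: atLeastAtMost_iff)
  ultimately have "has_mono_solution k {1..n} \<Delta>"
    unfolding has_mono_solution_def using range[of z] dvd pos by blast
  then show False using free by blast
qed

section \<open>The test polynomials and their common multiple\<close>

text \<open>Powers of \<open>k\<close> are split off in front, so that every member except
  \<open>2 * k\<close> reads as \<open>k^j\<close> times a divisor of \<open>cofactor k\<close>. The
  same spellings recur in \<open>test_polys_sum_free\<close>.\<close>

definition test_polys :: "int \<Rightarrow> int set" where
  "test_polys k =
    {1, k - 1, k, k + 1, 2 * k - 1, 2 * k, k * (k - 1), k^2 - k + 1, k^2 - 1, k^2, k^2 + k - 1,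
     k * (k + 1), k^2 + k + 1, 2 * k^2 - 2 * k + 1, k * (2 * k - 1), k * (k^2 - 2 * k + 2),
     k^3 - k^2 + 1, k * (k^2 - k + 1), k * (k^2 - 1), k^3 - k + 1, k^3, k^3 + k - 1,
     k^3 + k^2 - 2 * k + 1, k * (k^2 + k - 1), k^3 + k^2 - 1, k^2 * (k + 1),
     k * (2 * k^2 - 2 * k + 1), k^2 * (2 * k - 1), 2 * k^3 - 2 * k + 1, k * (k^3 - k^2 + 1),
     k^2 * (k^2 - k + 1), k^4 - k^2 + 1, k * (k^3 - k + 1), k^4, k * (k^3 + k - 1),
     k^4 + k^3 - k^2 - k + 1, k^2 * (k^2 + k - 1), k * (k^3 + k^2 - 1)}"

text \<open>Collects what remains of the test polynomials once powers of \<open>k\<close> and the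
  constant 2 are removed. To save degree, \<open>k^2 - 1\<close> serves for \<open>k - 1\<close> and
  \<open>k + 1\<close> as well.\<close>

definition cofactor :: "int \<Rightarrow> int" where
  "cofactor k =
    (k^2 - 1) * (2 * k - 1) * (k^2 + k - 1) * (k^2 - k + 1) * (k^2 + k + 1) *
    (2 * k^2 - 2 * k + 1) * (k^2 - 2 * k + 2) * (k^3 + k^2 - 1) * (k^3 + k - 1) *
    (k^3 - k + 1) * (k^3 + k^2 - 2 * k + 1) * (k^3 - k^2 + 1) * (2 * k^3 - 2 * k + 1) *
    (k^4 + k^3 - k^2 - k + 1) * (k^4 - k^2 + 1)"

definition common_multiple :: "int \<Rightarrow> int" where
  "common_multiple k = 2 * k^4 * cofactor k"

lemma test_polys_dvd_common_multiple:
  assumes "x \<in> test_polys k"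
  shows "x dvd common_multiple k"
proof -
  have "k - 1 dvd k^2 - 1" "k + 1 dvd k^2 - 1"
    by (simp_all add: power2_eq_square square_diff_one_factored)
  then have core: "k - 1 dvd cofactor k" "k + 1 dvd cofactor k" "k^2 - 1 dvd cofactor k"
    "2 * k - 1 dvd cofactor k" "k^2 + k - 1 dvd cofactor k" "k^2 - k + 1 dvd cofactor k"
    "k^2 + k + 1 dvd cofactor k" "2 * k^2 - 2 * k + 1 dvd cofactor k"
    "k^2 - 2 * k + 2 dvd cofactor k" "k^3 + k^2 - 1 dvd cofactor k"
    "k^3 + k - 1 dvd cofactor k" "k^3 - k + 1 dvd cofactor k"
    "k^3 + k^2 - 2 * k + 1 dvd cofactor k" "k^3 - k^2 + 1 dvd cofactor k"
    "2 * k^3 - 2 * k + 1 dvd cofactor k" "k^4 + k^3 - k^2 - k + 1 dvd cofactor k"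
    "k^4 - k^2 + 1 dvd cofactor k"
    unfolding cofactor_def by (auto intro: dvd_mult dvd_mult2)
  \<comment> \<open>The exponent 4 is forced by the member \<open>k^4\<close>; with the other
    divisors, \<open>j\<close> is at most 2.\<close>
  have scaled: "k^j * f dvd common_multiple k" if "f dvd cofactor k" "j \<le> 4" for f j
    unfolding common_multiple_def mult.assoc
    using that by (intro dvd_mult mult_dvd_mono le_imp_power_dvd)
  \<comment> \<open>This member is the reason for the constant 2 in
    \<open>common_multiple\<close>.\<close>
  have "2 * k dvd common_multiple k"
    unfolding common_multiple_def mult.assoc by (intro mult_dvd_mono) (simp_all add: power4_eq_xxxx)
  then show ?thesis
    using assms core[THEN scaled[where j = 0]] core[THEN scaled[where j = 1]]
      core[THEN scaled[where j = 2]]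
      scaled[of 1 0] scaled[of 1 1] scaled[of 1 2] scaled[of 1 3] scaled[of 1 4]
    unfolding test_polys_def by auto
qed

lemma test_polys_pos:
  assumes "3 \<le> k"
  shows "0 < cofactor k" and "\<And>x. x \<in> test_polys k \<Longrightarrow> 0 < x"
proof -
  \<comment> \<open>With these bounds between consecutive powers, positivity of each factor is
    linear arithmetic with the powers of \<open>k\<close> as atoms.\<close>
  have "3 * k \<le> k^2" "3 * k^2 \<le> k^3" "3 * k^3 \<le> k^4"
    using assms by (simp_all add: power2_eq_square power3_eq_cube power4_eq_xxxx mult_right_mono)
  then have core: "0 < k" "0 < k - 1" "0 < k + 1" "0 < k^2 - 1" "0 < 2 * k - 1"
    "0 < k^2 + k - 1" "0 < k^2 - k + 1"
    "0 < k^2 + k + 1" "0 < 2 * k^2 - 2 * k + 1" "0 < k^2 - 2 * k + 2" "0 < k^3 + k^2 - 1"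
    "0 < k^3 + k - 1" "0 < k^3 - k + 1" "0 < k^3 + k^2 - 2 * k + 1" "0 < k^3 - k^2 + 1"
    "0 < 2 * k^3 - 2 * k + 1" "0 < k^4 + k^3 - k^2 - k + 1" "0 < k^4 - k^2 + 1"
    using assms by linarith+
  then show "0 < cofactor k"
    unfolding cofactor_def by (intro mult_pos_pos)
  show "0 < x" if "x \<in> test_polys k" for x
    using that assms unfolding test_polys_def insert_iff empty_iff
    \<comment> \<open>Each member is literally built by products and powers from numerals and the
      terms in \<open>core\<close>.\<close>
    by (elim disjE FalseE; hypsubst)
      (intro mult_pos_pos zero_less_power zero_less_one zero_less_numeral core)+
qed

section \<open>Excluding 3-colourings of the test polynomials\<close>

text \<open>Unrolls the quantified hypothesis into the 123 clauses of the propositional refutation,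
  ordered by the right-hand side \<open>z\<close>. The predicate \<open>X\<close> stands for one
  colour class, so the list is written once and used for all three colours.\<close>

lemma test_polys_sum_free:
  fixes X :: "int \<Rightarrow> bool"
  assumes free: "\<forall>x\<in>test_polys k. \<forall>y\<in>test_polys k. \<forall>z\<in>test_polys k.
    x + (k - 1) * y = z \<longrightarrow> \<not> (X x \<and> X y \<and> X z)"
  shows "\<not> (X 1 \<and> X 1 \<and> X k)"
    and "\<not> (X (k + 1) \<and> X 1 \<and> X (2 * k))"
    and "\<not> (X (k - 1) \<and> X (k - 1) \<and> X (k * (k - 1)))"
    and "\<not> (X k \<and> X (k - 1) \<and> X (k^2 - k + 1))"
    and "\<not> (X (k - 1) \<and> X k \<and> X (k^2 - 1))"
    and "\<not> (X (k^2 - k + 1) \<and> X 1 \<and> X (k^2))"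
    and "\<not> (X (2 * k - 1) \<and> X (k - 1) \<and> X (k^2))"
    and "\<not> (X k \<and> X k \<and> X (k^2))"
    and "\<not> (X 1 \<and> X (k + 1) \<and> X (k^2))"
    and "\<not> (X (k^2) \<and> X 1 \<and> X (k^2 + k - 1))"
    and "\<not> (X k \<and> X (k + 1) \<and> X (k^2 + k - 1))"
    and "\<not> (X (2 * k) \<and> X k \<and> X (k * (k + 1)))"
    and "\<not> (X (k + 1) \<and> X (k + 1) \<and> X (k * (k + 1)))"
    and "\<not> (X (k^2) \<and> X (k - 1) \<and> X (2 * k^2 - 2 * k + 1))"
    and "\<not> (X (2 * k^2 - 2 * k + 1) \<and> X 1 \<and> X (k * (2 * k - 1)))"
    and "\<not> (X (k^2 + k - 1) \<and> X (k - 1) \<and> X (k * (2 * k - 1)))"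
    and "\<not> (X (2 * k - 1) \<and> X (2 * k - 1) \<and> X (k * (2 * k - 1)))"
    and "\<not> (X 1 \<and> X (k^2 - k + 1) \<and> X (k * (k^2 - 2 * k + 2)))"
    and "\<not> (X (k^2 - k + 1) \<and> X (k * (k - 1)) \<and> X (k^3 - k^2 + 1))"
    and "\<not> (X 1 \<and> X (k^2) \<and> X (k^3 - k^2 + 1))"
    and "\<not> (X (k^3 - k^2 + 1) \<and> X 1 \<and> X (k * (k^2 - k + 1)))"
    and "\<not> (X (k * (k^2 - 2 * k + 2)) \<and> X k \<and> X (k * (k^2 - k + 1)))"
    and "\<not> (X (k^2) \<and> X (k * (k - 1)) \<and> X (k * (k^2 - k + 1)))"
    and "\<not> (X (k^2 - k + 1) \<and> X (k^2 - k + 1) \<and> X (k * (k^2 - k + 1)))"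
    and "\<not> (X (k^2 - 1) \<and> X (k^2 - 1) \<and> X (k * (k^2 - 1)))"
    and "\<not> (X (k * (k^2 - k + 1)) \<and> X (k - 1) \<and> X (k^3 - k + 1))"
    and "\<not> (X (k^3 - k^2 + 1) \<and> X k \<and> X (k^3 - k + 1))"
    and "\<not> (X (2 * k^2 - 2 * k + 1) \<and> X (k * (k - 1)) \<and> X (k^3 - k + 1))"
    and "\<not> (X (k^2) \<and> X (k^2 - 1) \<and> X (k^3 - k + 1))"
    and "\<not> (X k \<and> X (k^2 + k - 1) \<and> X (k^3 - k + 1))"
    and "\<not> (X 1 \<and> X (k * (k + 1)) \<and> X (k^3 - k + 1))"
    and "\<not> (X (k^3 - k + 1) \<and> X 1 \<and> X (k^3))"
    and "\<not> (X (k^3 - k^2 + 1) \<and> X (k + 1) \<and> X (k^3))"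
    and "\<not> (X (k * (2 * k - 1)) \<and> X (k * (k - 1)) \<and> X (k^3))"
    and "\<not> (X (k^2 + k - 1) \<and> X (k^2 - 1) \<and> X (k^3))"
    and "\<not> (X (k^2) \<and> X (k^2) \<and> X (k^3))"
    and "\<not> (X (2 * k - 1) \<and> X (k^2 + k - 1) \<and> X (k^3))"
    and "\<not> (X k \<and> X (k * (k + 1)) \<and> X (k^3))"
    and "\<not> (X 1 \<and> X (k^2 + k + 1) \<and> X (k^3))"
    and "\<not> (X (k^3) \<and> X 1 \<and> X (k^3 + k - 1))"
    and "\<not> (X (k * (2 * k - 1)) \<and> X (k^2 - k + 1) \<and> X (k^3 + k - 1))"
    and "\<not> (X (k^2 + k - 1) \<and> X (k^2) \<and> X (k^3 + k - 1))"
    and "\<not> (X (2 * k - 1) \<and> X (k * (k + 1)) \<and> X (k^3 + k - 1))"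
    and "\<not> (X k \<and> X (k^2 + k + 1) \<and> X (k^3 + k - 1))"
    and "\<not> (X (k^3) \<and> X (k - 1) \<and> X (k^3 + k^2 - 2 * k + 1))"
    and "\<not> (X (k^3 - k + 1) \<and> X k \<and> X (k^3 + k^2 - 2 * k + 1))"
    and "\<not> (X (k * (2 * k - 1)) \<and> X (k^2 - 1) \<and> X (k^3 + k^2 - 2 * k + 1))"
    and "\<not> (X (k^2) \<and> X (k^2 + k - 1) \<and> X (k^3 + k^2 - 2 * k + 1))"
    and "\<not> (X (k^3 + k^2 - 2 * k + 1) \<and> X 1 \<and> X (k * (k^2 + k - 1)))"
    and "\<not> (X (k^3 + k - 1) \<and> X (k - 1) \<and> X (k * (k^2 + k - 1)))"
    and "\<not> (X (k^3) \<and> X k \<and> X (k * (k^2 + k - 1)))"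
    and "\<not> (X (k^3 - k + 1) \<and> X (k + 1) \<and> X (k * (k^2 + k - 1)))"
    and "\<not> (X (k * (k^2 - k + 1)) \<and> X (2 * k) \<and> X (k * (k^2 + k - 1)))"
    and "\<not> (X (k * (2 * k - 1)) \<and> X (k^2) \<and> X (k * (k^2 + k - 1)))"
    and "\<not> (X (k^2 + k - 1) \<and> X (k^2 + k - 1) \<and> X (k * (k^2 + k - 1)))"
    and "\<not> (X (k^2) \<and> X (k * (k + 1)) \<and> X (k * (k^2 + k - 1)))"
    and "\<not> (X (k^2 - k + 1) \<and> X (k^2 + k + 1) \<and> X (k * (k^2 + k - 1)))"
    and "\<not> (X (k * (k^2 + k - 1)) \<and> X 1 \<and> X (k^3 + k^2 - 1))"
    and "\<not> (X (k^3 + k - 1) \<and> X k \<and> X (k^3 + k^2 - 1))"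
    and "\<not> (X (k^3) \<and> X (k + 1) \<and> X (k^3 + k^2 - 1))"
    and "\<not> (X (k^2 + k - 1) \<and> X (k * (k + 1)) \<and> X (k^3 + k^2 - 1))"
    and "\<not> (X (k^2) \<and> X (k^2 + k + 1) \<and> X (k^3 + k^2 - 1))"
    and "\<not> (X (k * (k + 1)) \<and> X (k * (k + 1)) \<and> X (k^2 * (k + 1)))"
    and "\<not> (X (k^3) \<and> X (k * (k - 1)) \<and> X (k * (2 * k^2 - 2 * k + 1)))"
    and "\<not> (X (k^3 - k + 1) \<and> X (k^2 - k + 1) \<and> X (k * (2 * k^2 - 2 * k + 1)))"
    and "\<not> (X (2 * k^2 - 2 * k + 1) \<and> X (2 * k^2 - 2 * k + 1) \<and> X (k * (2 * k^2 - 2 * k + 1)))"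
    and "\<not> (X (k^2) \<and> X (k * (2 * k - 1)) \<and> X (k * (2 * k^2 - 2 * k + 1)))"
    and "\<not> (X (k * (2 * k^2 - 2 * k + 1)) \<and> X k \<and> X (k^2 * (2 * k - 1)))"
    and "\<not> (X (k^3 + k^2 - 2 * k + 1) \<and> X (k^2 - k + 1) \<and> X (k^2 * (2 * k - 1)))"
    and "\<not> (X (k * (k^2 - k + 1)) \<and> X (k * (k + 1)) \<and> X (k^2 * (2 * k - 1)))"
    and "\<not> (X (k^3 - k^2 + 1) \<and> X (k^2 + k + 1) \<and> X (k^2 * (2 * k - 1)))"
    and "\<not> (X (k * (2 * k - 1)) \<and> X (k * (2 * k - 1)) \<and> X (k^2 * (2 * k - 1)))"
    and "\<not> (X (k * (k^2 + k - 1)) \<and> X (k^2 - 1) \<and> X (2 * k^3 - 2 * k + 1))"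
    and "\<not> (X (k^3 + k^2 - 2 * k + 1) \<and> X (k^2) \<and> X (2 * k^3 - 2 * k + 1))"
    and "\<not> (X (k^3) \<and> X (k^2 + k - 1) \<and> X (2 * k^3 - 2 * k + 1))"
    and "\<not> (X (k^3 - k + 1) \<and> X (k * (k + 1)) \<and> X (2 * k^3 - 2 * k + 1))"
    and "\<not> (X (k^3 - k^2 + 1) \<and> X (k^3 - k^2 + 1) \<and> X (k * (k^3 - k^2 + 1)))"
    and "\<not> (X (k^2 - k + 1) \<and> X (k^3 - k + 1) \<and> X (k * (k^3 - k^2 + 1)))"
    and "\<not> (X k \<and> X (k^3) \<and> X (k * (k^3 - k^2 + 1)))"
    and "\<not> (X (k * (k^3 - k^2 + 1)) \<and> X k \<and> X (k^2 * (k^2 - k + 1)))"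
    and "\<not> (X (k^3 - k + 1) \<and> X (k^3 - k^2 + 1) \<and> X (k^2 * (k^2 - k + 1)))"
    and "\<not> (X (k^3 - k + 1) \<and> X (k * (k^2 - 1)) \<and> X (k^4 - k^2 + 1))"
    and "\<not> (X (k^3 - k^2 + 1) \<and> X (k^3) \<and> X (k^4 - k^2 + 1))"
    and "\<not> (X (k * (k^2 - 2 * k + 2)) \<and> X (k^3 + k - 1) \<and> X (k^4 - k^2 + 1))"
    and "\<not> (X (k^2 - k + 1) \<and> X (k * (k^2 + k - 1)) \<and> X (k^4 - k^2 + 1))"
    and "\<not> (X k \<and> X (k^3 + k^2 - 1) \<and> X (k^4 - k^2 + 1))"
    and "\<not> (X 1 \<and> X (k^2 * (k + 1)) \<and> X (k^4 - k^2 + 1))"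
    and "\<not> (X (k^4 - k^2 + 1) \<and> X 1 \<and> X (k * (k^3 - k + 1)))"
    and "\<not> (X (k * (k^3 - k^2 + 1)) \<and> X (k^2) \<and> X (k * (k^3 - k + 1)))"
    and "\<not> (X (k^3) \<and> X (k * (k^2 - 1)) \<and> X (k * (k^3 - k + 1)))"
    and "\<not> (X (k^3 - k + 1) \<and> X (k^3 - k + 1) \<and> X (k * (k^3 - k + 1)))"
    and "\<not> (X (k * (k^2 - k + 1)) \<and> X (k^3) \<and> X (k * (k^3 - k + 1)))"
    and "\<not> (X (k^2) \<and> X (k * (k^2 + k - 1)) \<and> X (k * (k^3 - k + 1)))"
    and "\<not> (X (2 * k - 1) \<and> X (k^3 + k^2 - 1) \<and> X (k * (k^3 - k + 1)))"
    and "\<not> (X k \<and> X (k^2 * (k + 1)) \<and> X (k * (k^3 - k + 1)))"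
    and "\<not> (X (k * (k^3 - k + 1)) \<and> X k \<and> X (k^4))"
    and "\<not> (X (k^4 - k^2 + 1) \<and> X (k + 1) \<and> X (k^4))"
    and "\<not> (X (k^2 * (k^2 - k + 1)) \<and> X (k^2) \<and> X (k^4))"
    and "\<not> (X (k * (k^3 - k^2 + 1)) \<and> X (k * (k + 1)) \<and> X (k^4))"
    and "\<not> (X (k^3) \<and> X (k^3) \<and> X (k^4))"
    and "\<not> (X (k * (2 * k - 1)) \<and> X (k * (k^2 + k - 1)) \<and> X (k^4))"
    and "\<not> (X (k^2) \<and> X (k^2 * (k + 1)) \<and> X (k^4))"
    and "\<not> (X (k^4) \<and> X k \<and> X (k * (k^3 + k - 1)))"
    and "\<not> (X (k * (k^2 + k - 1)) \<and> X (k^3) \<and> X (k * (k^3 + k - 1)))"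
    and "\<not> (X (k^3 + k - 1) \<and> X (k^3 + k - 1) \<and> X (k * (k^3 + k - 1)))"
    and "\<not> (X (k^4) \<and> X (k^2 - 1) \<and> X (k^4 + k^3 - k^2 - k + 1))"
    and "\<not> (X (k * (k^3 - k + 1)) \<and> X (k^2 + k - 1) \<and> X (k^4 + k^3 - k^2 - k + 1))"
    and "\<not> (X (k^4 - k^2 + 1) \<and> X (k * (k + 1)) \<and> X (k^4 + k^3 - k^2 - k + 1))"
    and "\<not> (X (2 * k^3 - 2 * k + 1) \<and> X (k * (k^2 - 1)) \<and> X (k^4 + k^3 - k^2 - k + 1))"
    and "\<not> (X (k^3 + k^2 - 2 * k + 1) \<and> X (k * (k^2 + k - 1)) \<and> X (k^4 + k^3 - k^2 - k + 1))"
    and "\<not> (X (k^3) \<and> X (k^3 + k^2 - 1) \<and> X (k^4 + k^3 - k^2 - k + 1))"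
    and "\<not> (X (k^3 - k + 1) \<and> X (k^2 * (k + 1)) \<and> X (k^4 + k^3 - k^2 - k + 1))"
    and "\<not> (X (k^4) \<and> X (k^2) \<and> X (k^2 * (k^2 + k - 1)))"
    and "\<not> (X (k * (k^3 - k + 1)) \<and> X (k * (k + 1)) \<and> X (k^2 * (k^2 + k - 1)))"
    and "\<not> (X (k^4 - k^2 + 1) \<and> X (k^2 + k + 1) \<and> X (k^2 * (k^2 + k - 1)))"
    and "\<not> (X (2 * k^3 - 2 * k + 1) \<and> X (k^3 - k + 1) \<and> X (k^2 * (k^2 + k - 1)))"
    and "\<not> (X (k * (k^2 + k - 1)) \<and> X (k * (k^2 + k - 1)) \<and> X (k^2 * (k^2 + k - 1)))"
    and "\<not> (X (k^3) \<and> X (k^2 * (k + 1)) \<and> X (k^2 * (k^2 + k - 1)))"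
    and "\<not> (X (k^2 * (k^2 + k - 1)) \<and> X k \<and> X (k * (k^3 + k^2 - 1)))"
    and "\<not> (X (k^4 + k^3 - k^2 - k + 1) \<and> X (k + 1) \<and> X (k * (k^3 + k^2 - 1)))"
    and "\<not> (X (k^4) \<and> X (k * (k + 1)) \<and> X (k * (k^3 + k^2 - 1)))"
    and "\<not> (X (k^3 + k^2 - 1) \<and> X (k^3 + k^2 - 1) \<and> X (k * (k^3 + k^2 - 1)))"
    and "\<not> (X (k * (k^2 + k - 1)) \<and> X (k^2 * (k + 1)) \<and> X (k * (k^3 + k^2 - 1)))"
  \<comment> \<open>Each clause leaves three memberships, settled by syntactic equality with a
    listed term, and one polynomial identity in \<open>k\<close>.\<close>
  by - (rule free[rule_format], (simp only: test_polys_def insert_iff simp_thms)+,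
      simp add: algebra_simps power2_eq_square power3_eq_cube power4_eq_xxxx)+

text \<open>The contradiction is purely propositional and the same for every \<open>k\<close>: the
  atoms are \<open>c p = i\<close> for the 38 listed terms \<open>p\<close> and the 3
  colours.\<close>

lemma test_polys_three_colouring:
  fixes c :: "int \<Rightarrow> nat"
  assumes colour: "\<forall>x\<in>test_polys k. c x < 3"
    and free: "\<And>i. \<forall>x\<in>test_polys k. \<forall>y\<in>test_polys k. \<forall>z\<in>test_polys k.
      x + (k - 1) * y = z \<longrightarrow> \<not> (c x = i \<and> c y = i \<and> c z = i)"
  shows False
proof -
  have "\<forall>x\<in>test_polys k. c x = 0 \<or> c x = 1 \<or> c x = 2"
    using colour by (force simp: numeral_eq_Suc less_Suc_eq)
  note cover = this[unfolded test_polys_def ball_simps]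
  show False
    \<comment> \<open>One covering disjunction per polynomial, against 123 clauses for each
      colour.\<close>
    using cover test_polys_sum_free[of k "\<lambda>x. c x = 0", OF free]
      test_polys_sum_free[of k "\<lambda>x. c x = 1", OF free]
      test_polys_sum_free[of k "\<lambda>x. c x = 2", OF free]
    by sat
qed

section \<open>Growth of the common multiple and the final bound\<close>

text \<open>\<open>cofactor\<close> has one linear, six quadratic, six cubic and two quartic
  factors, hence degree 1 + 12 + 18 + 8 = 39; the factor \<open>k^4\<close> brings this to
  43.\<close>

lemma common_multiple_bigo: "(\<lambda>k. real_of_int (common_multiple (int k))) \<in> O(\<lambda>k. real k ^ 43)"
  unfolding common_multiple_def cofactor_def by simp real_asymp

text \<open>The interval ends at \<open>L\<close> itself, the quotient belonging to the test
  polynomial 1. A colouring of it without a monochromatic solution would induce the colouring of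
  \<open>test_polys\<close> by \<open>\<Delta> (nat (L div x))\<close> that has just been
  excluded.\<close>

lemma f_rado_3_le_common_multiple:
  assumes "3 \<le> k"
  shows "f_rado 3 k \<le> enat (nat (common_multiple (int k)))"
proof -
  define L where "L = common_multiple (int k)"
  have "0 < L"
    unfolding L_def common_multiple_def using test_polys_pos(1)[of "int k"] assms by simp
  have "has_mono_solution k {1..nat L} \<Delta>" if "is_coloring 3 {1..nat L} \<Delta>" for \<Delta>
  proof (rule ccontr)
    assume free: "\<not> has_mono_solution k {1..nat L} \<Delta>"
    note dvd = test_polys_dvd_common_multiple[of _ "int k", folded L_def]
    note pos = test_polys_pos(2)[of "int k"]
    have "\<Delta> (nat (L div x)) < 3" if "x \<in> test_polys (int k)" for x
    proof -
      have "nat (L div x) \<in> {1..nat L}"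
        using dvd[OF that] pos[OF _ that] assms \<open>0 < L\<close> by (intro int_quotient_in_range) auto
      then show ?thesis
        using \<open>is_coloring 3 {1..nat L} \<Delta>\<close> unfolding is_coloring_def by auto
    qed
    moreover have "\<not> (\<Delta> (nat (L div x)) = i \<and> \<Delta> (nat (L div y)) = i \<and> \<Delta> (nat (L div z)) = i)"
      if "x \<in> test_polys (int k)" "y \<in> test_polys (int k)" "z \<in> test_polys (int k)"
        "x + (int k - 1) * y = z" for x y z i
      using that dvd pos assms \<open>0 < L\<close> by (intro divisor_colouring_sum_free[OF free]) auto
    ultimately show False
      using test_polys_three_colouring[of "int k" "\<lambda>x. \<Delta> (nat (L div x))"] by blast
  qed
  then show ?thesis
    unfolding f_rado_def L_def[symmetric] using \<open>0 < L\<close> by (intro Inf_lower) auto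
qed

theorem theorem5p2:
  "\<exists>(C::real) (K::nat). \<forall>k\<ge>K. ereal_of_enat (f_rado 3 k) \<le> ereal (C * real k ^ 43)"
proof -
  obtain C where "\<forall>\<^sub>F k in sequentially. norm (real_of_int (common_multiple (int k))) \<le> C * norm (real k ^ 43)"
    using common_multiple_bigo by (rule landau_o.bigE)
  then obtain K where K: "\<And>k. K \<le> k \<Longrightarrow> real_of_int (common_multiple (int k)) \<le> C * real k ^ 43"
    unfolding eventually_sequentially by fastforce
  \<comment> \<open>The threshold 3 is what the positivity of the test polynomials requires;
    \<open>K\<close> comes from the asymptotic estimate.\<close>
  have "ereal_of_enat (f_rado 3 k) \<le> ereal (C * real k ^ 43)" if "max 3 K \<le> k" for k
  proof -
    \<comment> \<open>Needed so that the conversion by \<open>nat\<close> preserves the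
      value.\<close>
    have "0 \<le> common_multiple (int k)"
      unfolding common_multiple_def using test_polys_pos(1)[of "int k"] that by simp
    moreover have "ereal_of_enat (f_rado 3 k) \<le> ereal_of_enat (enat (nat (common_multiple (int k))))"
      using f_rado_3_le_common_multiple[of k] that by (simp only: ereal_of_enat_le_iff)
    ultimately show ?thesis
      using K[of k] that by (simp add: order_trans)
  qed
  then show ?thesis
    by blast
qed

end
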